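(* Let $X$ be a set with a dissimilarity measure $d$, let $Y\subset X$ be a finite data set, and let $w:X\to[0,+\infty)$ be the weight function with $w(y)=1$ for all $y\in Y$ and $w(x)=0$ for $x\in X\setminus Y$. Let $Y_1,\ldots,Y_k$ be a fixed splitting of $Y$ into pairwise disjoint nonempty sets, and let $E$ be the (weighted) squared error function $$E(Y_1^w,\ldots,Y_k^w)=\sum_{i=1}^k \mathrm{ss}(Y_i^w).$$ Then for every $x\in X$ and every $i\in\{1,\ldots,k\}$ the derivative $\partial_iE(x,[Y^w_1,\ldots,Y^w_k])$ exists and $$\partial_iE(x,[Y^w_1,\ldots,Y^w_k])=d^2(x;Y_i).$$
   Context: A dissimilarity measure on $X$ is a function $d:X\times X\to[0,+\infty)$ with $d(y,y)=0$ and $d(y,z)=d(z,y)$ for all $y,z\in X$ (no triangle inequality is assumed). We write $d^2(y,z)=(d(y,z))^2$. Unweighted quantities. For finite nonempty $A,B\subset X$: $D\langle A,B\rangle=\sum_{a\in A}\sum_{b\in B}d^2(a,b)$, and $\mathrm{ss}(A)=\frac{1}{2|A|}D\langle A,A\rangle$. The mean square distance of $x\in X$ from $A$ is $$d^2(x;A):=\frac{1}{|A|}\left(D\langle\{x\},A\rangle-\mathrm{ss}(A)\right).$$ (This is a notation; it need not be the square of a number.) Weighted quantities. For a finite set $Z\subset X$ and a weight function $v:Z\to[0,+\infty)$, $Z^v$ denotes the set $Z$ with weights $v$, and $$|Z^v|=\sum_{z\in Z}v(z),\qquad D\langle Z^v,Z^v\rangle=\sum_{z\in Z}\sum_{z'\in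 Z}d^2(z,z')v(z)v(z'),\qquad \mathrm{ss}(Z^v)=\frac{1}{2|Z^v|}D\langle Z^v,Z^v\rangle.$$ The operator $\partial_i$. Let $E$ be a function of $k$ weighted clusters. For $x\in X$, $i\in\{1,\ldots,k\}$ and $h\ge 0$, let $E^i_{x,[Y_1^w,\ldots,Y_k^w]}(h)$ be the value of $E$ when the $i$-th weighted cluster $Y_i^w$ is replaced by the set $Y_i\cup\{x\}$ with the weights obtained from those of $Y_i^w$ (the weight $w(y)$ for $y\in Y_i$, and $0$ for $x$ if $x\notin Y_i$) by increasing the weight of $x$ by $h$, while all other clusters $Y_j^w$, $j\ne i$, are unchanged. Then $$\partial_iE(x,[Y^w_1,\ldots,Y^w_k]):=\left(E^i_{x,[Y^w_1,\ldots,Y^w_k]}\right)'(0),$$ the (right-hand) derivative at $h=0$, wherever it exists. *)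

theory Defs
  imports "HOL-Analysis.Analysis"
begin

definition dissimilarity_on :: "'a set \<Rightarrow> ('a \<Rightarrow> 'a \<Rightarrow> real) \<Rightarrow> bool" where
  "dissimilarity_on X d \<longleftrightarrow>
     (\<forall>y\<in>X. \<forall>z\<in>X. 0 \<le> d y z) \<and> (\<forall>y\<in>X. d y y = 0) \<and> (\<forall>y\<in>X. \<forall>z\<in>X. d y z = d z y)"

definition sqD :: "('a \<Rightarrow> 'a \<Rightarrow> real) \<Rightarrow> 'a set \<Rightarrow> 'a set \<Rightarrow> real" where
  "sqD d A B = (\<Sum>a\<in>A. \<Sum>b\<in>B. (d a b)\<^sup>2)"

definition ss :: "('a \<Rightarrow> 'a \<Rightarrow> real) \<Rightarrow> 'a set \<Rightarrow> real" where
  "ss d A = 1 / (2 * real (card A)) * sqD d A A"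

text \<open>The mean square distance \<open>d\<^sup>2(x;A)\<close>; despite the notation it may be negative.\<close>

definition mean_sq_dist :: "('a \<Rightarrow> 'a \<Rightarrow> real) \<Rightarrow> 'a \<Rightarrow> 'a set \<Rightarrow> real" where
  "mean_sq_dist d x A = 1 / real (card A) * (sqD d {x} A - ss d A)"

text \<open>A pair \<open>(Z, v)\<close> stands for the weighted set \<open>Z\<^sup>v\<close>; the values of \<open>v\<close> outside \<open>Z\<close> are
  irrelevant.\<close>

type_synonym 'a wset = "'a set \<times> ('a \<Rightarrow> real)"

definition wcard :: "'a wset \<Rightarrow> real" where
  "wcard = (\<lambda>(Z, v). \<Sum>z\<in>Z. v z)"

definition wsqD :: "('a \<Rightarrow> 'a \<Rightarrow> real) \<Rightarrow> 'a wset \<Rightarrow> 'a wset \<Rightarrow> real" where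
  "wsqD d = (\<lambda>(A, u) (B, v). \<Sum>a\<in>A. \<Sum>b\<in>B. (d a b)\<^sup>2 * u a * v b)"

definition wss :: "('a \<Rightarrow> 'a \<Rightarrow> real) \<Rightarrow> 'a wset \<Rightarrow> real" where
  "wss d C = 1 / (2 * wcard C) * wsqD d C C"

definition add_weight :: "'a \<Rightarrow> real \<Rightarrow> 'a wset \<Rightarrow> 'a wset" where
  "add_weight x h = (\<lambda>(Z, v).
     (insert x Z, \<lambda>z. (if z \<in> Z then v z else 0) + (if z = x then h else 0)))"

text \<open>A function of \<open>k\<close> weighted clusters takes a family indexed by \<open>nat\<close>, of which only the
  members with index in \<open>{1..k}\<close> matter.\<close>

definition perturbed ::
  "((nat \<Rightarrow> 'a wset) \<Rightarrow> real) \<Rightarrow> nat \<Rightarrow> 'a \<Rightarrow> (nat \<Rightarrow> 'a wset) \<Rightarrow> real \<Rightarrow> real" where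
  "perturbed E i x C h = E (C(i := add_weight x h (C i)))"

text \<open>The operator \<open>\<partial>\<^sub>i\<close> is the right-hand derivative at \<open>0\<close>, hence the filter
  \<open>at 0 within {0..}\<close>. Its value is meaningful only where \<open>partial_exists\<close> holds.\<close>

definition partial_exists ::
  "((nat \<Rightarrow> 'a wset) \<Rightarrow> real) \<Rightarrow> nat \<Rightarrow> 'a \<Rightarrow> (nat \<Rightarrow> 'a wset) \<Rightarrow> bool" where
  "partial_exists E i x C \<longleftrightarrow> perturbed E i x C differentiable (at 0 within {0..})"

definition partial ::
  "((nat \<Rightarrow> 'a wset) \<Rightarrow> real) \<Rightarrow> nat \<Rightarrow> 'a \<Rightarrow> (nat \<Rightarrow> 'a wset) \<Rightarrow> real" where
  "partial E i x C = vector_derivative (perturbed E i x C) (at 0 within {0..})"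

definition squared_error :: "('a \<Rightarrow> 'a \<Rightarrow> real) \<Rightarrow> nat \<Rightarrow> (nat \<Rightarrow> 'a wset) \<Rightarrow> real" where
  "squared_error d k C = (\<Sum>i = 1..k. wss d (C i))"

end

theory Submission
  imports Defs
begin

text \<open>Put n = |A| for a cluster A = Y_i of unit weights. Raising the weight of x by h turns
  |A| into n + h and, as D is bilinear in the weights, adds two equal cross terms h
  D\<langle>{x},A\<rangle> to D\<langle>A,A\<rangle>; the term in h^2 carries the factor d(x,x)^2 =
  0. So ss becomes the rational function (D\<langle>A,A\<rangle> + 2h D\<langle>{x},A\<rangle>) /
  (2(n + h)), and the quotient rule at h = 0 gives D\<langle>{x},A\<rangle>/n -
  D\<langle>A,A\<rangle>/(2n^2), which is d^2(x;A). The other clusters are constant in h. The two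
  expansions are \<open>wcard_add_weight\<close> and \<open>wsqD_add_weight\<close>;
  \<open>sum_add_weight\<close> makes both uniform in whether x already lies in A.\<close>

lemma sum_add_weight:
  fixes f :: "'a \<Rightarrow> real"
  assumes "finite A"
  shows "(\<Sum>z\<in>insert x A. f z * ((if z \<in> A then v z else 0) + (if z = x then h else 0)))
    = (\<Sum>z\<in>A. f z * v z) + h * f x"
proof -
  have "(\<Sum>z\<in>insert x A. f z * ((if z \<in> A then v z else 0) + (if z = x then h else 0)))
    = (\<Sum>z\<in>insert x A. if z \<in> A then f z * v z else 0)
      + (\<Sum>z\<in>insert x A. if z = x then f z * h else 0)"
    by (subst sum.distrib [symmetric], rule sum.cong) (auto simp: algebra_simps)
  \<comment> \<open>If x lies outside A, its old weight counts as 0, whatever \<open>v x\<close>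
    is.\<close>
  also have "(\<Sum>z\<in>insert x A. if z \<in> A then f z * v z else 0) = (\<Sum>z\<in>A. f z * v z)"
    using assms by (intro sum.mono_neutral_cong_right) auto
  also have "(\<Sum>z\<in>insert x A. if z = x then f z * h else 0) = h * f x"
    using assms by (simp add: mult.commute)
  finally show ?thesis .
qed

lemma wcard_add_weight:
  assumes "finite A"
  shows "wcard (add_weight x h (A, v)) = wcard (A, v) + h"
  using sum_add_weight [OF assms, of "\<lambda>_. 1" v x h] by (simp add: wcard_def add_weight_def)

lemma wsqD_add_weight:
  assumes "finite A" and "d x x = 0" and sym: "\<And>a. a \<in> A \<Longrightarrow> d a x = d x a"
  shows "wsqD d (add_weight x h (A, v)) (add_weight x h (A, v))
    = wsqD d (A, v) (A, v) + 2 * h * (\<Sum>a\<in>A. (d x a)\<^sup>2 * v a)"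
proof -
  define u where "u = (\<lambda>z. (if z \<in> A then v z else 0) + (if z = x then h else 0))"
  have sum_u: "(\<Sum>z\<in>insert x A. f z * u z) = (\<Sum>z\<in>A. f z * v z) + h * f x"
    for f :: "'a \<Rightarrow> real"
    unfolding u_def by (rule sum_add_weight [OF \<open>finite A\<close>])
  \<comment> \<open>\<open>g a\<close> is the inner sum over the enlarged cluster, so
    \<open>sum_u\<close> is used once for each of the two arguments of D.\<close>
  define g where "g a = (\<Sum>b\<in>A. (d a b)\<^sup>2 * v b) + h * (d a x)\<^sup>2" for a
  have "wsqD d (add_weight x h (A, v)) (add_weight x h (A, v))
      = (\<Sum>a\<in>insert x A. (\<Sum>b\<in>insert x A. (d a b)\<^sup>2 * u b) * u a)"
    unfolding wsqD_def add_weight_def u_def [symmetric] prod.case sum_distrib_right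
    by (simp only: mult_ac)
  also have "\<dots> = (\<Sum>a\<in>insert x A. g a * u a)"
    by (simp only: sum_u g_def)
  also have "\<dots> = (\<Sum>a\<in>A. g a * v a) + h * g x"
    by (rule sum_u)
  also have "(\<Sum>a\<in>A. g a * v a)
      = wsqD d (A, v) (A, v) + h * (\<Sum>a\<in>A. (d x a)\<^sup>2 * v a)"
    by (simp add: g_def wsqD_def sym sum.distrib sum_distrib_left sum_distrib_right algebra_simps)
  \<comment> \<open>The term of second order in h disappears here.\<close>
  also have "g x = (\<Sum>a\<in>A. (d x a)\<^sup>2 * v a)"
    using \<open>d x x = 0\<close> by (simp add: g_def)
  finally show ?thesis by simp
qed

text \<open>The denominator 2(n + h) is nonzero near h = 0 because A is nonempty, so even the
  two-sided derivative exists; negative h is harmless in the formula.\<close>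

lemma wss_add_weight_has_derivative:
  assumes "finite A" and "A \<noteq> {}" and one: "\<And>a. a \<in> A \<Longrightarrow> v a = 1"
    and "d x x = 0" and "\<And>a. a \<in> A \<Longrightarrow> d a x = d x a"
  shows "((\<lambda>h. wss d (add_weight x h (A, v))) has_real_derivative mean_sq_dist d x A) (at 0)"
proof -
  define n where "n = real (card A)"
  have n: "n > 0"
    using assms(1,2) by (simp add: n_def card_gt_0_iff)
  have [simp]: "wcard (A, v) = n" "wsqD d (A, v) (A, v) = sqD d A A"
    using one by (simp_all add: wcard_def wsqD_def sqD_def n_def)
  have "(\<lambda>h. wss d (add_weight x h (A, v)))
      = (\<lambda>h. (sqD d A A + 2 * h * sqD d {x} A) / (2 * (n + h)))"
    using assms by (simp add: wss_def wcard_add_weight wsqD_add_weight sqD_def)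
  moreover have "((\<lambda>h. (sqD d A A + 2 * h * sqD d {x} A) / (2 * (n + h)))
      has_real_derivative mean_sq_dist d x A) (at 0)"
    unfolding mean_sq_dist_def ss_def n_def [symmetric] using n
    by (auto intro!: derivative_eq_intros simp: field_simps)
  ultimately show ?thesis by simp
qed

lemma perturbed_squared_error:
  assumes "i \<in> {1..k}"
  shows "perturbed (squared_error d k) i x C h
    = wss d (add_weight x h (C i)) + (\<Sum>j\<in>{1..k} - {i}. wss d (C j))"
  using assms by (simp add: perturbed_def squared_error_def sum.remove)

theorem mainTheorem1:
  fixes X Y :: "'a set" and d :: "'a \<Rightarrow> 'a \<Rightarrow> real" and w :: "'a \<Rightarrow> real"
    and k :: nat and S :: "nat \<Rightarrow> 'a set"
  assumes "dissimilarity_on X d"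
    and "Y \<subseteq> X" and "finite Y"
    and "\<forall>y\<in>Y. w y = 1" and "\<forall>x\<in>X - Y. w x = 0"
    and "(\<Union>i\<in>{1..k}. S i) = Y"
    and "disjoint_family_on S {1..k}"
    and "\<forall>i\<in>{1..k}. S i \<noteq> {}"
  shows "\<forall>x\<in>X. \<forall>i\<in>{1..k}.
    partial_exists (squared_error d k) i x (\<lambda>j. (S j, w)) \<and>
    partial (squared_error d k) i x (\<lambda>j. (S j, w)) = mean_sq_dist d x (S i)"
proof (intro ballI)
  fix x i
  assume x: "x \<in> X" and i: "i \<in> {1..k}"
  let ?P = "perturbed (squared_error d k) i x (\<lambda>j. (S j, w))"
  have SY: "S i \<subseteq> Y"
    using assms(6) i by blast
  have "((\<lambda>h. wss d (add_weight x h (S i, w))) has_real_derivative mean_sq_dist d x (S i)) (at 0)"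
  proof (rule wss_add_weight_has_derivative)
    show "finite (S i)"
      using SY \<open>finite Y\<close> by (rule finite_subset)
    show "S i \<noteq> {}"
      using assms(8) i by blast
    show "w a = 1" if "a \<in> S i" for a
      using assms(4) SY that by blast
    show "d x x = 0"
      using assms(1) x by (simp add: dissimilarity_on_def)
    show "d a x = d x a" if "a \<in> S i" for a
      using assms(1,2) SY that x unfolding dissimilarity_on_def by blast
  qed
  then have "(?P has_real_derivative mean_sq_dist d x (S i)) (at 0)"
    \<comment> \<open>The clusters other than the i-th add a constant.\<close>
    unfolding perturbed_squared_error [OF i, abs_def] by (auto intro!: derivative_eq_intros)
  then have deriv: "(?P has_vector_derivative mean_sq_dist d x (S i)) (at 0 within {0..})"
    by (simp add: has_real_derivative_iff_has_vector_derivative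
        has_vector_derivative_at_within)
  \<comment> \<open>0 is a limit point of {0..}, so the one-sided derivative is unique and the value
    chosen by \<open>vector_derivative\<close> must be the one found.\<close>
  have "at (0::real) within {0..} \<noteq> bot"
    by (simp add: at_within_Ici_at_right)
  with deriv show "partial_exists (squared_error d k) i x (\<lambda>j. (S j, w)) \<and>
      partial (squared_error d k) i x (\<lambda>j. (S j, w)) = mean_sq_dist d x (S i)"
    unfolding partial_exists_def partial_def
    by (auto intro: vector_derivative_within differentiableI_vector)
qed

end
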